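(* Let $\mathbb{P}$ be the space of polynomials with complex coefficients and $T:\mathbb{P}\to\mathbb{P}$ a linear operator with $\deg(T(p))=\deg(p)-1$ for every polynomial $p$ (so $T$ annihilates constants). Let $(r_n)_{n\ge0}$ be a sequence of polynomials with $r_0=1$, $\deg r_n=n$, and $T(r_n)=r_{n-1}$ for $n\ge1$. Let $(s_n)_{n\ge0}$ be defined recursively by $s_0=1$ and $\sum_{j=0}^n s_j(x)r_{n-j}(x)=0$ for $n\ge1$. Let $\langle\cdot,\cdot\rangle:\mathbb{P}\times\mathbb{P}\to\mathbb{C}$ be a bilinear form, let $(\psi_i)_{i\ge0}$ be polynomials with $\deg\psi_i=i$, and put $\mu_j^i=\langle r_j,\psi_i\rangle$, $i,j\ge0$. Define $p_0=1$ and, for $n\ge1$, $$p_n(x)=\left|\begin{matrix}\mu_n^0&\mu_n^1&\cdots&\mu_n^{n-1}&r_n(x)\\ \mu_{n-1}^0&\mu_{n-1}^1&\cdots&\mu_{n-1}^{n-1}&r_{n-1}(x)\\ \vdots&\vdots&\ddots&\vdots&\vdots\\ \mu_0^0&\mu_0^1&\cdots&\mu_0^{n-1}&1\end{matrix}\right|,$$ and define $$q_n^i(x)=\sum_{j=0}^n\mu_j^i\,s_{n-j}(x),\qquad n,i\ge0.$$ Then for all integers $n,m\ge1$, $$\det\left(T^{i-1}(p_{m+j-1})\right)_{i,j=1}^n=C_{n,m}\det\left(q^{j-1}_{n+m-i}\right)_{i,j=1}^m,\qquad C_{n,m}=(-1)^{\binom n2}\prod_{j=0}^{n-2}\Omega_{m+j},$$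 where $$\Omega_n=\left|\begin{matrix}\mu_n^0&\cdots&\mu_n^n\\ \vdots&\ddots&\vdots\\ \mu_0^0&\cdots&\mu_0^n\end{matrix}\right|.$$ In particular $C_{n,m}$ is independent of $x$.
   Context: An empty product equals $1$. $T^k$ denotes the $k$-fold composition of $T$. Both determinants are polynomials in $x$ and the identity is an identity of polynomials. *)

theory Defs
  imports Complex_Main "Jordan_Normal_Form.Determinant"
begin

text \<open>The zero polynomial has degree \<open>-\<infinity>\<close> on paper, whereas \<^term>\<open>degree 0 = 0\<close> here. So
  ``\<open>deg p = n\<close>'' includes \<open>p \<noteq> 0\<close>, which matters for \<open>n = 0\<close>.\<close>

definition has_degree :: "complex poly \<Rightarrow> nat \<Rightarrow> bool" where
  "has_degree p n \<longleftrightarrow> p \<noteq> 0 \<and> degree p = n"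

definition lowers_degree :: "(complex poly \<Rightarrow> complex poly) \<Rightarrow> bool" where
  "lowers_degree T \<longleftrightarrow>
     (\<forall>c. T [:c:] = 0) \<and> (\<forall>p n. has_degree p (Suc n) \<longrightarrow> has_degree (T p) n)"

definition bilinear_form :: "(complex poly \<Rightarrow> complex poly \<Rightarrow> complex) \<Rightarrow> bool" where
  "bilinear_form B \<longleftrightarrow>
     (\<forall>q. Vector_Spaces.linear smult (*) (\<lambda>p. B p q)) \<and>
     (\<forall>p. Vector_Spaces.linear smult (*) (\<lambda>q. B p q))"

text \<open>\<open>moment B r \<psi> i j\<close> is \<open>\<mu>\<^sub>j\<^sup>i\<close>: superscript first. Matrix indices start at 0
  in all the determinants below.\<close>

definition moment ::
  "(complex poly \<Rightarrow> complex poly \<Rightarrow> complex) \<Rightarrow> (nat \<Rightarrow> complex poly) \<Rightarrow> (nat \<Rightarrow> complex poly)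
    \<Rightarrow> nat \<Rightarrow> nat \<Rightarrow> complex" where
  "moment B r \<psi> i j = B (r j) (\<psi> i)"

definition p_poly :: "(nat \<Rightarrow> nat \<Rightarrow> complex) \<Rightarrow> (nat \<Rightarrow> complex poly) \<Rightarrow> nat \<Rightarrow> complex poly" where
  "p_poly \<mu> r n =
     (if n = 0 then 1
      else det (mat (n + 1) (n + 1) (\<lambda>(k, l). if l < n then [:\<mu> l (n - k):] else r (n - k))))"

definition q_poly :: "(nat \<Rightarrow> nat \<Rightarrow> complex) \<Rightarrow> (nat \<Rightarrow> complex poly) \<Rightarrow> nat \<Rightarrow> nat \<Rightarrow> complex poly" where
  "q_poly \<mu> s i n = (\<Sum>j = 0..n. smult (\<mu> i j) (s (n - j)))"

definition Omega :: "(nat \<Rightarrow> nat \<Rightarrow> complex) \<Rightarrow> nat \<Rightarrow> complex" where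
  "Omega \<mu> n = det (mat (n + 1) (n + 1) (\<lambda>(k, l). \<mu> l (n - k)))"

text \<open>The product over \<open>0 \<le> j \<le> n - 2\<close>, written as \<open>j < n - 1\<close> so that it is empty for
  \<open>n = 1\<close> despite truncated subtraction.\<close>

definition C_const :: "(nat \<Rightarrow> nat \<Rightarrow> complex) \<Rightarrow> nat \<Rightarrow> nat \<Rightarrow> complex" where
  "C_const \<mu> n m = (-1) ^ (n choose 2) * (\<Prod>j<n - 1. Omega \<mu> (m + j))"

end

theory Submission
  imports Defs "Jordan_Normal_Form.Char_Poly"
begin

text \<open>
  Applying \<open>T\<close> to \<open>p\<^sub>k\<close> only shifts the indices of the \<open>r\<^sub>j\<close> in its last column. Let \<open>U\<close> be the square
  matrix of size \<open>m + n\<close> whose rows are the moment sequences \<open>\<mu>\<^sup>0, \<dots>, \<mu>\<^bsup>m-1\<^esup>\<close> followed by \<open>n\<close> shifts of \<open>r\<close>.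
  Let the columns of \<open>V\<close> be \<open>m\<close> unit vectors followed by the coefficient vectors of
  \<open>p\<^sub>m, \<dots>, p\<^bsub>m+n-1\<^esub>\<close> in the basis \<open>r\<^sub>j\<close>, and let \<open>Z\<close> be the unitriangular Toeplitz matrix of \<open>s\<close>.
  Since \<open>p\<^sub>k\<close> is orthogonal to \<open>\<psi>\<^sub>0, \<dots>, \<psi>\<^bsub>k-1\<^esub>\<close>, \<open>U V\<close> is block triangular with diagonal blocks a moment
  minor and the left-hand matrix; since \<open>r\<close> and \<open>s\<close> are convolution inverses, \<open>U Z\<close> consists of an
  identity block, a zero block and the right-hand matrix. Comparing determinants gives the
  identity up to a common moment minor, which is cancelled after a perturbation. Determinants are
  handled with increasing row indices; the signs come from reversing rows.
\<close>

section \<open>Bordered determinants and their cofactors\<close>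

definition bordered :: "(nat \<Rightarrow> nat \<Rightarrow> 'a) \<Rightarrow> (nat \<Rightarrow> 'a) \<Rightarrow> nat \<Rightarrow> 'a :: comm_ring_1" where
  "bordered \<mu> f k = det (mat (Suc k) (Suc k) (\<lambda>(j, l). if l < k then \<mu> l j else f j))"

text \<open>The weight of \<open>f j\<close> in \<open>bordered \<mu> f k\<close>. The zeros for
  \<open>j > k\<close> let the expansion run over any range beyond \<open>k\<close>, so these
  weights can form a column of a larger matrix.\<close>

definition border_cofactor :: "(nat \<Rightarrow> nat \<Rightarrow> 'a) \<Rightarrow> nat \<Rightarrow> nat \<Rightarrow> 'a :: comm_ring_1" where
  "border_cofactor \<mu> k j = (if j \<le> k then
     cofactor (mat (Suc k) (Suc k) (\<lambda>(j, l). if l < k then \<mu> l j else 0)) j k else 0)"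

definition lead_minor :: "(nat \<Rightarrow> nat \<Rightarrow> 'a) \<Rightarrow> nat \<Rightarrow> 'a :: comm_ring_1" where
  "lead_minor \<mu> k = det (mat k k (\<lambda>(j, l). \<mu> l j))"

text \<open>For the sequence \<open>r\<close> this is T^i applied to \<open>r j\<close>; the value 0
  for \<open>j < i\<close> reflects that T annihilates constants.\<close>

definition shift :: "(nat \<Rightarrow> 'a) \<Rightarrow> nat \<Rightarrow> nat \<Rightarrow> 'a :: zero" where
  "shift r i j = (if i \<le> j then r (j - i) else 0)"

lemma bordered_laplace:
  "bordered \<mu> f k = (\<Sum>j<Suc k. f j * border_cofactor \<mu> k j)"
proof -
  define A where
    "A g = mat (Suc k) (Suc k) (\<lambda>(j, l). if l < k then \<mu> l j else g j)" for g :: "nat \<Rightarrow> 'a"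
  have "mat_delete (A f) j k = mat_delete (A (\<lambda>_. 0)) j k" if "j < Suc k" for j
    using that by (intro eq_matI) (auto simp: A_def mat_delete_def)
  then have cof: "cofactor (A f) j k = border_cofactor \<mu> k j" if "j < Suc k" for j
    using that by (simp add: cofactor_def border_cofactor_def A_def)
  have "det (A f) = (\<Sum>j<Suc k. A f $$ (j, k) * cofactor (A f) j k)"
    by (rule laplace_expansion_column) (auto simp: A_def)
  also have "\<dots> = (\<Sum>j<Suc k. f j * border_cofactor \<mu> k j)"
    by (rule sum.cong[OF refl], subst cof) (auto simp: A_def)
  finally show ?thesis by (simp add: bordered_def A_def)
qed

lemma bordered_expand:
  assumes "k < N"
  shows "bordered \<mu> f k = (\<Sum>j<N. f j * border_cofactor \<mu> k j)"
  unfolding bordered_laplace using assms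
  by (intro sum.mono_neutral_left) (auto simp: border_cofactor_def)

lemma border_cofactor_diag: "border_cofactor \<mu> k k = lead_minor \<mu> k"
proof -
  have "mat_delete (mat (Suc k) (Suc k) (\<lambda>(j, l). if l < k then \<mu> l j else 0)) k k
      = mat k k (\<lambda>(j, l). \<mu> l j)"
    by (intro eq_matI) (auto simp: mat_delete_def)
  then show ?thesis
    by (simp add: border_cofactor_def cofactor_def lead_minor_def power_add flip: power_mult_distrib)
qed

text \<open>The border repeats column \<open>i\<close>. This is the orthogonality of p_k to
  \<psi>_i.\<close>

lemma bordered_moment_zero:
  assumes "i < k"
  shows "bordered \<mu> (\<mu> i) k = 0"
  unfolding bordered_def
  by (rule det_identical_columns[of _ "Suc k" i k]) (use assms in \<open>auto intro!: eq_vecI\<close>)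

section \<open>Column scaling and row reversal\<close>

lemma det_scale_columns:
  "det (mat n n (\<lambda>(i, j). c j * f i j)) = (\<Prod>j<n. c j) * det (mat n n (\<lambda>(i, j). f i j))"
  for c :: "nat \<Rightarrow> 'a :: comm_ring_1"
proof -
  let ?F = "mat n n (\<lambda>(i, j). f i j)"
  define D where "D = mat n n (\<lambda>(i, j). if i = j then c j else 0)"
  have "mat n n (\<lambda>(i, j). c j * f i j) = ?F * D"
    by (intro eq_matI) (auto simp: D_def scalar_prod_def if_distrib mult.commute cong: if_cong)
  moreover have "det (?F * D) = det ?F * det D"
    by (rule det_mult[of _ n]) (auto simp: D_def)
  moreover have "det D = (\<Prod>j<n. c j)"
    by (subst det_upper_triangular[of _ n])
      (auto simp: D_def diag_mat_def prod.list_conv_set_nth atLeast0LessThan)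
  ultimately show ?thesis by (simp add: mult.commute)
qed

lemma det_anti_identity:
  "det (mat n n (\<lambda>(i, j). if i + j = n - 1 then 1 else 0)) = (-1) ^ (n choose 2 :: nat)"
  (is "det (?J n) = _")
proof (induction n)
  case 0
  then show ?case by (simp add: numeral_2_eq_2)
next
  case (Suc n)
  \<comment> \<open>The 1 in the top right corner passes \<open>n\<close> columns, so the signs add
    up to 0 + 1 + ... + (n - 1) in the exponent.\<close>
  have "?J (Suc n) = four_block_mat (0\<^sub>m 1 n) (1\<^sub>m 1) (?J n) (0\<^sub>m n 1)"
    by (intro eq_matI) auto
  also have "det \<dots> = (-1) ^ n * det (?J n)"
    by (subst det_four_block_mat_lower_right_zero_col) auto
  finally show ?case using Suc by (simp add: power_add numeral_2_eq_2)
qed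

lemma det_reverse_rows:
  "det (mat n n (\<lambda>(i, j). f (n - 1 - i) j)) = (-1) ^ (n choose 2) * det (mat n n (\<lambda>(i, j). f i j))"
  for f :: "nat \<Rightarrow> nat \<Rightarrow> 'a :: comm_ring_1"
proof -
  let ?F = "mat n n (\<lambda>(i, j). f i j)"
  let ?J = "mat n n (\<lambda>(i, j). if i + j = n - 1 then 1 else 0 :: 'a)"
  have "(\<Sum>k = 0..<n. (if i + k = n - 1 then 1 else 0) * f k j) = f (n - 1 - i) j"
    if "i < n" for i j
  proof -
    have "(\<Sum>k = 0..<n. (if i + k = n - 1 then 1 else 0) * f k j)
        = (\<Sum>k = 0..<n. if k = n - 1 - i then f k j else 0)"
      using that by (intro sum.cong) auto
    then show ?thesis using that by simp
  qed
  then have "mat n n (\<lambda>(i, j). f (n - 1 - i) j) = ?J * ?F"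
    by (intro eq_matI) (auto simp: scalar_prod_def)
  moreover have "det (?J * ?F) = det ?J * det ?F"
    by (rule det_mult[of _ n]) auto
  ultimately show ?thesis by (simp add: det_anti_identity[unfolded One_nat_def])
qed

section \<open>Two evaluations of the determinant of U\<close>

text \<open>The entries are q^l_{n+i}: the right-hand matrix with rows reversed and then transposed,
  the form in which it occurs as a block of U Z.\<close>

definition convolution_matrix ::
  "(nat \<Rightarrow> nat \<Rightarrow> 'a) \<Rightarrow> (nat \<Rightarrow> 'a) \<Rightarrow> nat \<Rightarrow> nat \<Rightarrow> 'a :: comm_ring_1 mat" where
  "convolution_matrix \<mu> s n m = mat m m (\<lambda>(l, i). \<Sum>j<Suc (n + i). \<mu> l j * s (n + i - j))"

definition bordered_matrix ::
  "(nat \<Rightarrow> nat \<Rightarrow> 'a) \<Rightarrow> (nat \<Rightarrow> 'a) \<Rightarrow> nat \<Rightarrow> nat \<Rightarrow> 'a :: comm_ring_1 mat" where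
  "bordered_matrix \<mu> r n m = mat n n (\<lambda>(i, k). bordered \<mu> (shift r i) (m + k))"

definition moment_shift_matrix ::
  "(nat \<Rightarrow> nat \<Rightarrow> 'a) \<Rightarrow> (nat \<Rightarrow> 'a) \<Rightarrow> nat \<Rightarrow> nat \<Rightarrow> 'a :: comm_ring_1 mat" where
  "moment_shift_matrix \<mu> r n m =
     mat (m + n) (m + n) (\<lambda>(i, j). if i < m then \<mu> i j else shift r (i - m) j)"

lemma det_moment_shift_bordered:
  fixes \<mu> :: "nat \<Rightarrow> nat \<Rightarrow> 'a :: idom"
  shows "det (moment_shift_matrix \<mu> r n m) * (\<Prod>k<n. lead_minor \<mu> (m + k))
       = lead_minor \<mu> m * det (bordered_matrix \<mu> r n m)"
proof -
  let ?N = "m + n"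
  let ?U = "moment_shift_matrix \<mu> r n m"
  define V where "V = mat ?N ?N (\<lambda>(j, k). if k < m then if j = k then 1 else 0
    else border_cofactor \<mu> k j)"
  define L where "L = mat m m (\<lambda>(i, j). \<mu> i j)"
  define M where "M = mat n m (\<lambda>(i, j). shift r i j)"
  have U: "?U \<in> carrier_mat ?N ?N" and V: "V \<in> carrier_mat ?N ?N"
    by (auto simp: moment_shift_matrix_def V_def)
  have entry: "(?U * V) $$ (i, k) = (\<Sum>j<?N. ?U $$ (i, j) * V $$ (j, k))" if "i < ?N" "k < ?N" for i k
    using U V that by (simp add: scalar_prod_def atLeast0LessThan)
  have left: "(?U * V) $$ (i, k) = ?U $$ (i, k)" if "i < ?N" "k < m" for i k
  proof -
    have "(?U * V) $$ (i, k) = (\<Sum>j<?N. if j = k then ?U $$ (i, j) else 0)"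
      unfolding entry[OF that(1) trans_less_add1[OF that(2)]]
      by (intro sum.cong refl) (use that in \<open>auto simp: V_def\<close>)
    then show ?thesis using that by simp
  qed
  \<comment> \<open>Multiplying row \<open>i\<close> of U by the cofactor column is a Laplace
    expansion, so that row becomes the border.\<close>
  have right: "(?U * V) $$ (i, k) = bordered \<mu> (\<lambda>j. if i < m then \<mu> i j else shift r (i - m) j) k"
    if "i < ?N" "k < ?N" "m \<le> k" for i k
    unfolding entry[OF that(1,2)] bordered_expand[OF that(2)]
    by (intro sum.cong refl) (use that in \<open>auto simp: V_def moment_shift_matrix_def\<close>)
  have "?U * V = four_block_mat L (0\<^sub>m m n) M (bordered_matrix \<mu> r n m)"
    (is "_ = ?B")
  proof (rule eq_matI)
    fix i k assume "i < dim_row ?B" "k < dim_col ?B"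
    then have ik: "i < ?N" "k < ?N" by (auto simp: L_def bordered_matrix_def)
    show "(?U * V) $$ (i, k) = ?B $$ (i, k)"
    proof (cases "k < m")
      case True
      with ik show ?thesis
        by (subst left) (auto simp: moment_shift_matrix_def L_def M_def bordered_matrix_def)
    next
      case False
      with ik show ?thesis
        by (subst right) (auto simp: L_def M_def bordered_matrix_def bordered_moment_zero)
    qed
  qed (use U V in \<open>auto simp: L_def M_def bordered_matrix_def\<close>)
  then have "det (?U * V) = det L * det (bordered_matrix \<mu> r n m)"
    by (simp, intro det_four_block_mat_upper_right_zero) (auto simp: L_def M_def bordered_matrix_def)
  moreover have "det L = lead_minor \<mu> m"
  proof -
    have "L\<^sup>T = mat m m (\<lambda>(j, l). \<mu> l j)" by (intro eq_matI) (auto simp: L_def)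
    then show ?thesis
      using det_transpose[of L m] by (simp add: L_def lead_minor_def)
  qed
  moreover have "det V = (\<Prod>k<n. lead_minor \<mu> (m + k))"
  proof -
    \<comment> \<open>V is upper triangular because the cofactors vanish for
      \<open>j > k\<close>.\<close>
    have "det V = (\<Prod>k<?N. V $$ (k, k))"
      using V by (subst det_upper_triangular[of _ ?N])
        (auto simp: V_def border_cofactor_def diag_mat_def prod.list_conv_set_nth atLeast0LessThan)
    also have "\<dots> = (\<Prod>k<?N. if k < m then 1 else lead_minor \<mu> k)"
      by (intro prod.cong) (auto simp: V_def border_cofactor_diag)
    also have "\<dots> = (\<Prod>k\<in>{m..<m + n}. lead_minor \<mu> k)"
      by (intro prod.mono_neutral_cong_right) auto
    also have "\<dots> = (\<Prod>k<n. lead_minor \<mu> (m + k))"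
      using prod.shift_bounds_nat_ivl[of "lead_minor \<mu>" 0 m n]
      by (simp add: atLeast0LessThan add.commute)
    finally show ?thesis .
  qed
  ultimately show ?thesis using det_mult[OF U V] by simp
qed

lemma det_moment_shift_convolution:
  fixes \<mu> :: "nat \<Rightarrow> nat \<Rightarrow> 'a :: idom"
  assumes "r 0 = 1" "s 0 = 1"
    and conv: "\<And>k. k \<ge> 1 \<Longrightarrow> (\<Sum>j = 0..k. s j * r (k - j)) = 0"
  shows "det (moment_shift_matrix \<mu> r n m) = (-1) ^ (n * m) * det (convolution_matrix \<mu> s n m)"
proof -
  let ?N = "m + n"
  let ?U = "moment_shift_matrix \<mu> r n m"
  define Z where "Z = mat ?N ?N (\<lambda>(i, j). shift s i j)"
  define W where "W = ?U * Z"
  define X where "X = mat m n (\<lambda>(i, k). \<Sum>j<Suc k. \<mu> i j * s (k - j))"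
  have U: "?U \<in> carrier_mat ?N ?N" and Z: "Z \<in> carrier_mat ?N ?N"
    by (auto simp: moment_shift_matrix_def Z_def)
  have W: "W \<in> carrier_mat ?N ?N" using U Z by (auto simp: W_def)
  have entry: "W $$ (i, k) = (\<Sum>j<Suc k. ?U $$ (i, j) * s (k - j))"
    if "i < ?N" "k < ?N" for i k
  proof -
    have "W $$ (i, k) = (\<Sum>j<?N. ?U $$ (i, j) * shift s j k)"
      using U Z that by (simp add: W_def Z_def scalar_prod_def atLeast0LessThan)
    also have "\<dots> = (\<Sum>j<Suc k. ?U $$ (i, j) * s (k - j))"
      using that by (intro sum.mono_neutral_cong_right) (auto simp: shift_def)
    finally show ?thesis .
  qed
  have top: "W $$ (i, k) = (\<Sum>j<Suc k. \<mu> i j * s (k - j))" if "i < m" "k < ?N" for i k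
    using that by (subst entry) (auto simp: moment_shift_matrix_def intro!: sum.cong)
  have bottom: "W $$ (m + i, k) = (if i = k then 1 else 0)" if "i < n" "k < ?N" for i k
  proof -
    have eq: "W $$ (m + i, k) = (\<Sum>j<Suc k. shift r i j * s (k - j))"
      using that by (subst entry) (auto simp: moment_shift_matrix_def intro!: sum.cong)
    show ?thesis
    proof (cases "i \<le> k")
      case True
      have "(\<Sum>j<Suc k. shift r i j * s (k - j)) = (\<Sum>j\<in>{i..k}. r (j - i) * s (k - j))"
        by (intro sum.mono_neutral_cong_right) (auto simp: shift_def)
      \<comment> \<open>Reversing the summation gives the convolution of \<open>s\<close> and
        \<open>r\<close> at \<open>k - i\<close>: it is 0 unless \<open>i = k\<close>, where it is
        \<open>s 0 * r 0 = 1\<close>.\<close>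
      also have "\<dots> = (\<Sum>j = 0..k - i. s j * r (k - i - j))"
        by (rule sum.reindex_bij_witness[of _ "\<lambda>j. k - j" "\<lambda>j. k - j"])
          (use True in \<open>auto simp: mult.commute diff_right_commute\<close>)
      also have "\<dots> = (if i = k then 1 else 0)"
        using conv[of "k - i"] True assms(1,2) by auto
      finally show ?thesis using eq by simp
    next
      case False
      then have "(\<Sum>j<Suc k. shift r i j * s (k - j)) = 0"
        by (intro sum.neutral) (auto simp: shift_def)
      with eq False show ?thesis by simp
    qed
  qed
  have bottom': "W $$ (i, k) = (if i - m = k then 1 else 0)" if "m \<le> i" "i < ?N" "k < ?N" for i k
    using bottom[of "i - m" k] that by simp
  \<comment> \<open>Moving the last \<open>m\<close> columns in front of the first \<open>n\<close>
    costs \<open>m * n\<close> transpositions and puts the identity block at the lower right, with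
    zeros to its left.\<close>
  have swap: "det W = (-1) ^ (m * n) *
      det (mat ?N ?N (\<lambda>(i, j). W $$ (i, if j < m then j + n else j - m)))" (is "_ = _ * det ?W'")
    by (rule det_swap_cols[OF W])
  have "?W' = four_block_mat (convolution_matrix \<mu> s n m) X (0\<^sub>m n m) (1\<^sub>m n)"
    by (intro eq_matI)
      (auto simp: convolution_matrix_def X_def top bottom' add.commute simp del: sum.lessThan_Suc)
  then have "det ?W' = det (convolution_matrix \<mu> s n m)"
    by (simp, subst det_four_block_mat_lower_left_zero[of _ m _ n]) (auto simp: convolution_matrix_def X_def)
  moreover have "det Z = 1"
    by (subst det_upper_triangular[of _ ?N])
      (auto simp: Z_def shift_def diag_mat_def prod.list_conv_set_nth assms)
  ultimately show ?thesis
    using swap det_mult[OF U Z] by (simp add: W_def mult.commute)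
qed

section \<open>Cancelling the common moment minor\<close>

text \<open>The diagonal of V starts with \<open>lead_minor \<mu> m\<close>, which is also the
  determinant of the other diagonal block of U V; cancelling it leaves the minors of orders m+1 to
  m+n-1.\<close>

lemma det_bordered_matrix_nonsingular:
  fixes \<mu> :: "nat \<Rightarrow> nat \<Rightarrow> 'a :: idom"
  assumes "r 0 = 1" "s 0 = 1"
    and "\<And>k. k \<ge> 1 \<Longrightarrow> (\<Sum>j = 0..k. s j * r (k - j)) = 0"
    and "n \<ge> 1" and nz: "lead_minor \<mu> m \<noteq> 0"
  shows "det (bordered_matrix \<mu> r n m)
       = (-1) ^ (n * m) * (\<Prod>k<n - 1. lead_minor \<mu> (Suc (m + k))) * det (convolution_matrix \<mu> s n m)"
proof -
  have "(\<Prod>k<n. lead_minor \<mu> (m + k)) = lead_minor \<mu> m * (\<Prod>k<n - 1. lead_minor \<mu> (Suc (m + k)))"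
    using \<open>n \<ge> 1\<close> by (cases n) (simp_all add: prod.lessThan_Suc_shift del: prod.lessThan_Suc)
  then have "lead_minor \<mu> m * det (bordered_matrix \<mu> r n m) = lead_minor \<mu> m *
      ((-1) ^ (n * m) * (\<Prod>k<n - 1. lead_minor \<mu> (Suc (m + k))) * det (convolution_matrix \<mu> s n m))"
    using det_moment_shift_bordered[of \<mu> r n m, symmetric] det_moment_shift_convolution[of r s, OF assms(1-3)]
    by (simp add: ac_simps)
  with nz show ?thesis by simp
qed

section \<open>Transport along ring homomorphisms: embedding of constants and evaluation of
  polynomials\<close>

context comm_ring_hom
begin

lemma hom_lead_minor: "hom (lead_minor \<mu> k) = lead_minor (\<lambda>i j. hom (\<mu> i j)) k"
  unfolding lead_minor_def hom_det[symmetric]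
  by (intro arg_cong[of _ _ det] eq_matI) auto

lemma hom_bordered: "hom (bordered \<mu> f k) = bordered (\<lambda>i j. hom (\<mu> i j)) (\<lambda>j. hom (f j)) k"
  unfolding bordered_def hom_det[symmetric]
  by (intro arg_cong[of _ _ det] eq_matI) auto

text \<open>A cofactor is the bordered determinant whose border is a unit vector, so this reduces to
  \<open>hom_bordered\<close>.\<close>

lemma hom_border_cofactor:
  "hom (border_cofactor \<mu> k j) = border_cofactor (\<lambda>i j. hom (\<mu> i j)) k j"
proof -
  have "hom (border_cofactor \<mu> k j) = hom (bordered \<mu> (\<lambda>i. if i = j then 1 else 0) k)"
    by (simp add: bordered_laplace border_cofactor_def if_distrib[of "\<lambda>x. x * _"]
      del: sum.lessThan_Suc cong: if_cong)
  also have "\<dots> = border_cofactor (\<lambda>i j. hom (\<mu> i j)) k j"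
    unfolding hom_bordered
    by (simp add: bordered_laplace border_cofactor_def if_distrib[of "\<lambda>x. x * _"] if_distrib[of hom]
        del: sum.lessThan_Suc cong: if_cong)
  finally show ?thesis .
qed

lemma hom_det_bordered_matrix:
  "hom (det (bordered_matrix \<mu> r n m))
     = det (bordered_matrix (\<lambda>i j. hom (\<mu> i j)) (\<lambda>j. hom (r j)) n m)"
  unfolding bordered_matrix_def hom_det[symmetric]
  by (intro arg_cong[of _ _ det] eq_matI)
    (auto simp: hom_bordered shift_def[abs_def] if_distrib[of hom] cong: if_cong)

lemma hom_det_convolution_matrix:
  "hom (det (convolution_matrix \<mu> s n m))
     = det (convolution_matrix (\<lambda>i j. hom (\<mu> i j)) (\<lambda>j. hom (s j)) n m)"
  unfolding convolution_matrix_def hom_det[symmetric]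
  by (intro arg_cong[of _ _ det] eq_matI) (auto simp: hom_distribs)

end

lemma comm_ring_hom_const_poly: "comm_ring_hom (\<lambda>a :: 'a :: comm_ring_1. [:a:])"
  by unfold_locales (auto simp: one_pCons)

text \<open>Perturbing the moments to \<open>\<mu> l j + t \<delta>\<^bsub>l j\<^esub>\<close> over the polynomial ring in \<open>t\<close> makes the
  leading minor a characteristic polynomial, hence nonzero, so that it can be cancelled before
  setting \<open>t = 0\<close>.\<close>

lemma det_bordered_matrix:
  fixes \<mu> :: "nat \<Rightarrow> nat \<Rightarrow> 'a :: idom"
  assumes "r 0 = 1" "s 0 = 1"
    and conv: "\<And>k. k \<ge> 1 \<Longrightarrow> (\<Sum>j = 0..k. s j * r (k - j)) = 0"
    and "n \<ge> 1"
  shows "det (bordered_matrix \<mu> r n m)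
       = (-1) ^ (n * m) * (\<Prod>k<n - 1. lead_minor \<mu> (Suc (m + k))) * det (convolution_matrix \<mu> s n m)"
proof -
  interpret const: comm_ring_hom "\<lambda>a :: 'a. [:a:]" by (rule comm_ring_hom_const_poly)
  define \<mu>' where "\<mu>' l j = [:\<mu> l j, if l = j then 1 else 0:]" for l j
  \<comment> \<open>The characteristic polynomial of A is det(t I - A), hence the negated
    moments.\<close>
  have "lead_minor \<mu>' m = char_poly (mat m m (\<lambda>(j, l). - \<mu> l j))"
    unfolding lead_minor_def char_poly_defs
    by (intro arg_cong[of _ _ det] eq_matI) (auto simp: \<mu>'_def)
  then have "coeff (lead_minor \<mu>' m) m = 1"
    using degree_monic_char_poly[of "mat m m (\<lambda>(j, l). - \<mu> l j)" m] by simp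
  then have nz: "lead_minor \<mu>' m \<noteq> 0" by auto
  have "(\<Sum>j = 0..k. [:s j:] * [:r (k - j):]) = 0" if "k \<ge> 1" for k
    unfolding const.hom_mult[symmetric] const.hom_sum[symmetric] conv[OF that] by simp
  from det_bordered_matrix_nonsingular[of "\<lambda>j. [:r j:]" "\<lambda>j. [:s j:]" n \<mu>' m,
      OF _ _ this \<open>n \<ge> 1\<close> nz]
  have "poly (det (bordered_matrix \<mu>' (\<lambda>j. [:r j:]) n m)) 0 = poly ((-1) ^ (n * m) *
      (\<Prod>k<n - 1. lead_minor \<mu>' (Suc (m + k))) * det (convolution_matrix \<mu>' (\<lambda>j. [:s j:]) n m)) 0"
    by (simp only: assms const.hom_one)
  then show ?thesis
    by (simp only: poly_hom.hom_mult poly_hom.hom_prod poly_hom.hom_power poly_hom.hom_uminus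
        poly_hom.hom_one poly_hom.hom_lead_minor poly_hom.hom_det_bordered_matrix poly_hom.hom_det_convolution_matrix \<mu>'_def) simp
qed

section \<open>Translation to p, q, \<Omega> and T, with signs\<close>

lemma p_poly_eq_bordered:
  assumes "r 0 = 1"
  shows "p_poly \<mu> r k = (-1) ^ (Suc k choose 2) * bordered (\<lambda>l j. [:\<mu> l j:]) r k"
proof (cases "k = 0")
  case True
  then show ?thesis
    using assms det_single[of "mat (Suc 0) (Suc 0) (\<lambda>(j, l). if l < 0 then [:\<mu> l j:] else r j)"]
    by (simp add: p_poly_def bordered_def numeral_2_eq_2)
next
  case False
  then show ?thesis
    using det_reverse_rows[of "Suc k" "\<lambda>j l. if l < k then [:\<mu> l j:] else r j"]
    by (simp add: p_poly_def bordered_def cong: if_cong)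
qed

text \<open>\<Omega>_k has \<open>k + 1\<close> rows, so it carries the same reversal sign as
  p_k.\<close>

lemma Omega_eq_lead_minor: "Omega \<mu> k = (-1) ^ (Suc k choose 2) * lead_minor \<mu> (Suc k)"
  using det_reverse_rows[of "Suc k" "\<lambda>j l. \<mu> l j"] by (simp add: Omega_def lead_minor_def)

theorem theorem4p1:
  fixes T :: "complex poly \<Rightarrow> complex poly"
    and r s \<psi> :: "nat \<Rightarrow> complex poly"
    and B :: "complex poly \<Rightarrow> complex poly \<Rightarrow> complex"
    and \<mu> :: "nat \<Rightarrow> nat \<Rightarrow> complex"
    and n m :: nat
  assumes "Vector_Spaces.linear smult smult T"
    and "lowers_degree T"
    and "r 0 = 1"
    and "\<And>k. has_degree (r k) k"
    and "\<And>k. k \<ge> 1 \<Longrightarrow> T (r k) = r (k - 1)"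
    and "s 0 = 1"
    and "\<And>k. k \<ge> 1 \<Longrightarrow> (\<Sum>j = 0..k. s j * r (k - j)) = 0"
    and "bilinear_form B"
    and "\<And>i. has_degree (\<psi> i) i"
    and "\<mu> = moment B r \<psi>"
    and "n \<ge> 1" and "m \<ge> 1"
  shows "det (mat n n (\<lambda>(i, j). (T ^^ i) (p_poly \<mu> r (m + j))))
       = smult (C_const \<mu> n m) (det (mat m m (\<lambda>(i, j). q_poly \<mu> s j (n + m - 1 - i))))"
proof -
  interpret T: Vector_Spaces.linear smult smult T by (rule assms(1))
  interpret const: comm_ring_hom "\<lambda>a :: complex. [:a:]" by (rule comm_ring_hom_const_poly)
  define \<nu> where "\<nu> l j = [:\<mu> l j:]" for l j
  define \<epsilon> where "\<epsilon> k = (-1 :: complex) ^ (Suc k choose 2)" for k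
  have sign: "(-1) ^ k * p = smult ((-1) ^ k) p" for k and p :: "complex poly"
    by (induction k) auto
  \<comment> \<open>At \<open>i = j\<close> the index drops below 0, and T(r_0) = T(1) = 0 matches
    the default value of \<open>shift\<close>.\<close>
  have T_shift: "T (shift r i j) = shift r (Suc i) j" for i j
  proof -
    have "T 1 = 0" using assms(2) by (metis lowers_degree_def one_pCons)
    then show ?thesis
      using assms(3) assms(5)[of "j - i"] by (cases "i = j") (auto simp: shift_def T.zero)
  qed
  \<comment> \<open>The cofactors are constants, so linearity lets T act on the border
    alone.\<close>
  have expand: "bordered \<nu> f k = (\<Sum>j<Suc k. smult (border_cofactor \<mu> k j) (f j))" for f k
    unfolding bordered_laplace \<nu>_def const.hom_border_cofactor[symmetric] by simp
  have T_pow: "(T ^^ i) (p_poly \<mu> r k) = smult (\<epsilon> k) (bordered \<nu> (shift r i) k)" for i k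
  proof (induction i)
    case 0
    have "shift r 0 = r" by (auto simp: shift_def)
    then show ?case
      by (simp add: p_poly_eq_bordered[of r, OF assms(3)] sign \<epsilon>_def \<nu>_def[abs_def])
  next
    case (Suc i)
    then show ?case by (simp add: expand T.scale T.sum T_shift del: sum.lessThan_Suc)
  qed
  let ?E = "\<Prod>j<n. \<epsilon> (m + j)"
  let ?L = "\<Prod>k<n - 1. lead_minor \<mu> (Suc (m + k))"
  have lhs: "det (mat n n (\<lambda>(i, j). (T ^^ i) (p_poly \<mu> r (m + j))))
      = smult ?E (det (bordered_matrix \<nu> r n m))"
    using det_scale_columns[of n "\<lambda>j. [:\<epsilon> (m + j):]" "\<lambda>i j. bordered \<nu> (shift r i) (m + j)"]
    by (simp add: T_pow bordered_matrix_def const.hom_prod[symmetric])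
  have rhs: "det (mat m m (\<lambda>(i, j). q_poly \<mu> s j (n + m - 1 - i)))
      = smult ((-1) ^ (m choose 2)) (det (convolution_matrix \<nu> s n m))"
  proof -
    have "mat m m (\<lambda>(i, j). q_poly \<mu> s j (n + m - 1 - i))
        = mat m m (\<lambda>(i, j). q_poly \<mu> s j (n + (m - 1 - i)))"
      by (intro eq_matI) (auto intro!: arg_cong[of _ _ "q_poly \<mu> s _"])
    moreover have "mat m m (\<lambda>(i, j). q_poly \<mu> s j (n + i)) = (convolution_matrix \<nu> s n m)\<^sup>T"
      by (intro eq_matI) (auto simp: q_poly_def convolution_matrix_def \<nu>_def atLeast0AtMost
        lessThan_Suc_atMost simp del: sum.lessThan_Suc)
    moreover have "det (convolution_matrix \<nu> s n m)\<^sup>T = det (convolution_matrix \<nu> s n m)"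
      by (rule det_transpose[of _ m]) (simp add: convolution_matrix_def)
    ultimately show ?thesis
      using det_reverse_rows[of m "\<lambda>i j. q_poly \<mu> s j (n + i)"] by (simp add: sign)
  qed
  have "det (bordered_matrix \<nu> r n m) = smult ((-1) ^ (n * m) * ?L) (det (convolution_matrix \<nu> s n m))"
  proof -
    have "[:(-1) ^ (n * m) * ?L:] = (-1) ^ (n * m) * (\<Prod>k<n - 1. lead_minor \<nu> (Suc (m + k)))"
      unfolding const.hom_mult const.hom_power const.hom_prod const.hom_lead_minor
        const.hom_uminus const.hom_one \<nu>_def[abs_def] ..
    from this[symmetric] show ?thesis
      by (simp only: det_bordered_matrix[of r s n \<nu> m, OF assms(3,6,7,11)]) simp
  qed
  \<comment> \<open>The signs of p_m, ..., p_{m+n-2} are those of the \<Omega> factors in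
    \<open>C_const\<close>. The last one, with exponent \<open>(m + n) choose 2\<close>, splits into
    \<open>m choose 2\<close>, \<open>n choose 2\<close> and \<open>n * m\<close>, which absorbs the
    sign of the column swap.\<close>
  moreover have "?E * ((-1) ^ (n * m) * ?L) = C_const \<mu> n m * (-1) ^ (m choose 2)"
  proof -
    have C: "C_const \<mu> n m = (-1) ^ (n choose 2) * (\<Prod>j<n - 1. \<epsilon> (m + j)) * ?L"
      by (simp add: C_const_def Omega_eq_lead_minor \<epsilon>_def prod.distrib)
    have split: "?E = (\<Prod>j<n - 1. \<epsilon> (m + j)) * \<epsilon> (m + n - 1)"
      using \<open>n \<ge> 1\<close> by (cases n) auto
    have "(m + n) choose 2 = (m choose 2) + (n choose 2) + n * m"
      by (induction n) (auto simp: numeral_2_eq_2)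
    then have "\<epsilon> (m + n - 1) * (-1) ^ (n * m) = (-1) ^ (n choose 2) * (-1) ^ (m choose 2)"
      using \<open>n \<ge> 1\<close> by (simp add: \<epsilon>_def power_add ac_simps flip: power_mult_distrib)
    then show ?thesis unfolding C split by (simp add: ac_simps)
  qed
  ultimately show ?thesis unfolding lhs rhs by simp
qed

end
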